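(* Let $(x_n)_{n\in\mathbb Z}$ be the sequence determined by independent indeterminates $x_0,x_1$ and, for all $n\in\mathbb Z$, $$x_{2n}x_{2n-2}=1+x_{2n-1},\qquad x_{2n+1}x_{2n-1}=1+x_{2n}^4 .$$ (1) Set $$y^{(0)}_1=\frac{1+x_1}{x_0^2},\quad y^{(0)}_2=\frac{x_0^4+(1+x_1)^2}{x_0^4x_1},\quad y^{(0)}_3=\frac{x_0^4+1+x_1}{x_0^2x_1},$$ $$y^{(1)}_1=\frac{x_2^4+1+x_1}{x_2^2x_1},\quad y^{(1)}_2=\frac{x_2^4+(1+x_1)^2}{x_2^4x_1},\quad y^{(1)}_3=\frac{1+x_1}{x_2^2}.$$ Then, as formal power series in $t$, $$\sum_{n\ge 0}x_{2n}t^n=\cfrac{x_0}{1-ty^{(0)}_1-\cfrac{t^2y^{(0)}_2}{1-ty^{(0)}_3}},\qquad \sum_{n\ge 0}x_{2n+2}t^n=\cfrac{x_2}{1-ty^{(1)}_1-\cfrac{t^2y^{(1)}_2}{1-ty^{(1)}_3}} .$$ (2) For all $n\ge 0$, $$x_{2n}=\sum_{q,\ell,r,s,m\ge 0}x_0^{1+4(q+\ell)-2n-4(r+s)}\,x_1^{m-q-\ell}\binom{n-q-\ell}{q-r,\,r}\binom{q+\ell-1}{\ell-s,\,s}\binom{n+2r+s-2q-\ell}{m},$$ $$x_{2n+2}=\sum_{q,\ell,r,s,m\ge 0}x_2^{1+2n-4(q+\ell+r+s)}\,x_1^{q+\ell+m-n}\binom{n-q-\ell}{q-r,\,r,\,s}\binom{q+\ell-1}{\ell}\binom{2r+s+\ell}{m}.$$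 (3) For every $n\ge 0$ the odd variable $x_{2n+1}=x_{2n}x_{2n+2}-1$ is a Laurent polynomial with non-negative integer coefficients in $(x_0,x_1)$, and also in $(x_1,x_2)$.
   Context: This is the rank 2 affine cluster algebra recursion (with trivial coefficients) of type $(b,c)=(1,4)$. All $x_n$ are elements of the field of rational functions in $x_0,x_1$, equivalently in $x_1,x_2$, since $x_0x_2=1+x_1$. Multinomial convention: $\binom{N}{m_1,\dots,m_k}=\frac{N!}{m_1!\cdots m_k!\,(N-\sum_i m_i)!}$ if all $m_i\ge 0$ and $\sum_i m_i\le N$, and it is $0$ otherwise, with the single exception $\binom{-1}{0,\dots,0}=1$. The case $k=1$ is the ordinary binomial coefficient. *)

theory Defs
  imports
    "HOL-Computational_Algebra.Computational_Algebra"
    "HOL-Library.Groups_Big_Fun"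
begin

text \<open>The field of rational functions over the rationals in two independent indeterminates,
  realised as the fraction field of \<open>\<rat>[x\<^sub>0][x\<^sub>1]\<close>.\<close>

type_synonym ratfun2 = "rat poly poly fract"

definition X0 :: ratfun2 where "X0 = Fract [:[:0, 1:]:] 1"

definition X1 :: ratfun2 where "X1 = Fract [:0, 1:] 1"

text \<open>\<open>multinom N [m\<^sub>1, \<dots>, m\<^sub>k]\<close> has integer arguments, which may be negative, and the
  exceptional value 1 at \<open>N = -1\<close>, \<open>m\<^sub>1 = \<dots> = m\<^sub>k = 0\<close>. In the main case \<open>N \<ge> 0\<close> holds
  automatically and the division is exact.\<close>

definition multinom :: "int \<Rightarrow> int list \<Rightarrow> nat" where
  "multinom N ms =
     (if (\<forall>m\<in>set ms. 0 \<le> m) \<and> sum_list ms \<le> N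
      then fact (nat N) div ((\<Prod>m\<leftarrow>ms. fact (nat m)) * fact (nat (N - sum_list ms)))
      else if N = -1 \<and> (\<forall>m\<in>set ms. m = 0) then 1
      else 0)"

definition nonneg_int_Laurent_in :: "'a::field \<Rightarrow> 'a \<Rightarrow> 'a \<Rightarrow> bool" where
  "nonneg_int_Laurent_in a b f \<longleftrightarrow>
     (\<exists>c :: int \<times> int \<Rightarrow> nat. finite {k. c k \<noteq> 0} \<and>
        f = (\<Sum>(i, j) | c (i, j) \<noteq> 0. of_nat (c (i, j)) * a powi i * b powi j))"

text \<open>The recursion determines exactly one sequence. Its members do not vanish, since they are
  quotients of polynomials that are positive at \<open>x\<^sub>0 = x\<^sub>1 = 1\<close>.\<close>

definition pos_ratfun :: "ratfun2 \<Rightarrow> bool" where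
  "pos_ratfun f \<longleftrightarrow>
     (\<exists>p q. f = Fract p q \<and> poly (poly p 1) 1 > 0 \<and> poly (poly q 1) 1 > 0)"

lemma pos_ratfun_nonzero: "pos_ratfun f \<Longrightarrow> f \<noteq> 0"
proof
  assume "pos_ratfun f" and f0: "f = 0"
  then obtain p q where f: "f = Fract p q" and p: "poly (poly p 1) 1 > (0::rat)"
    and q: "poly (poly q 1) 1 > (0::rat)"
    unfolding pos_ratfun_def by blast
  have "p \<noteq> 0" "q \<noteq> 0" using p q by auto
  then show False using f f0 by (simp add: Zero_fract_def eq_fract)
qed

lemma pos_ratfun_X0: "pos_ratfun X0"
  unfolding pos_ratfun_def X0_def
  by (rule exI[of _ "[:[:0, 1:]:]"], rule exI[of _ 1]) simp

lemma pos_ratfun_X1: "pos_ratfun X1"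
  unfolding pos_ratfun_def X1_def
  by (rule exI[of _ "[:0, 1:]"], rule exI[of _ 1]) simp

lemma pos_ratfun_mult:
  assumes "pos_ratfun f" "pos_ratfun g"
  shows "pos_ratfun (f * g)"
proof -
  from assms obtain p q r s where "f = Fract p q" "g = Fract r s"
    and "poly (poly p 1) 1 > (0::rat)" "poly (poly q 1) 1 > (0::rat)"
    and "poly (poly r 1) 1 > (0::rat)" "poly (poly s 1) 1 > (0::rat)"
    unfolding pos_ratfun_def by blast
  then show ?thesis unfolding pos_ratfun_def
    by (intro exI[of _ "p * r"] exI[of _ "q * s"]) simp
qed

lemma pos_ratfun_inverse: "pos_ratfun f \<Longrightarrow> pos_ratfun (inverse f)"
  unfolding pos_ratfun_def by (metis inverse_fract)

lemma pos_ratfun_one: "pos_ratfun 1"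
  unfolding pos_ratfun_def One_fract_def by (intro exI[of _ 1]) simp

lemma pos_ratfun_power: "pos_ratfun f \<Longrightarrow> pos_ratfun (f ^ n)"
  by (induction n) (auto simp: pos_ratfun_one pos_ratfun_mult)

lemma pos_ratfun_one_plus:
  assumes "pos_ratfun f"
  shows "pos_ratfun (1 + f)"
proof -
  from assms obtain p q where f: "f = Fract p q"
    and p: "poly (poly p 1) 1 > (0::rat)" and q: "poly (poly q 1) 1 > (0::rat)"
    unfolding pos_ratfun_def by blast
  have "q \<noteq> 0" using q by auto
  then have "1 + f = Fract (q + p) q"
    by (simp add: f One_fract_def)
  then show ?thesis unfolding pos_ratfun_def using p q
    by (intro exI[of _ "q + p"] exI[of _ q]) simp
qed

lemma pos_ratfun_step:
  "pos_ratfun f \<Longrightarrow> pos_ratfun g \<Longrightarrow> pos_ratfun ((1 + f ^ n) / g)"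
  by (simp add: divide_inverse pos_ratfun_mult pos_ratfun_inverse pos_ratfun_one_plus
      pos_ratfun_power)

fun half_seq :: "nat \<Rightarrow> nat \<Rightarrow> ratfun2 \<Rightarrow> ratfun2 \<Rightarrow> nat \<Rightarrow> ratfun2" where
  "half_seq c d a b 0 = a"
| "half_seq c d a b (Suc 0) = b"
| "half_seq c d a b (Suc (Suc n)) =
     (1 + half_seq c d a b (Suc n) ^ (if even n then c else d)) / half_seq c d a b n"

lemma pos_ratfun_half_seq:
  "pos_ratfun a \<Longrightarrow> pos_ratfun b \<Longrightarrow> pos_ratfun (half_seq c d a b n)"
  by (induction c d a b n rule: half_seq.induct) (auto intro: pos_ratfun_step)

lemma half_seq_rec:
  assumes "pos_ratfun a" "pos_ratfun b"
  shows "half_seq c d a b (Suc (Suc n)) * half_seq c d a b n =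
           1 + half_seq c d a b (Suc n) ^ (if even n then c else d)"
  using pos_ratfun_nonzero[OF pos_ratfun_half_seq[OF assms]] by simp

definition exch_exp :: "int \<Rightarrow> nat" where
  "exch_exp k = (if even k then 4 else 1)"

lemma exchange_alt:
  fixes x :: "int \<Rightarrow> ratfun2"
  shows "((\<forall>n. x (2*n) * x (2*n - 2) = 1 + x (2*n - 1)) \<and>
          (\<forall>n. x (2*n + 1) * x (2*n - 1) = 1 + x (2*n) ^ 4)) \<longleftrightarrow>
         (\<forall>k. x (k + 1) * x (k - 1) = 1 + x k ^ exch_exp k)"
    (is "?L \<longleftrightarrow> ?R")
proof
  assume L: ?L
  show ?R
  proof
    fix k :: int
    show "x (k + 1) * x (k - 1) = 1 + x k ^ exch_exp k"
    proof (cases "even k")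
      case True
      then obtain n where "k = 2*n" by blast
      then show ?thesis using L by (simp add: exch_exp_def)
    next
      case False
      then obtain n where k: "k = 2*n + 1" by (elim oddE)
      have "x (2*(n+1)) * x (2*(n+1) - 2) = 1 + x (2*(n+1) - 1)" using L by blast
      then show ?thesis by (simp add: k exch_exp_def algebra_simps)
    qed
  qed
next
  assume R: ?R
  show ?L
  proof (intro conjI allI)
    fix n :: int
    show "x (2*n) * x (2*n - 2) = 1 + x (2*n - 1)"
      using R[rule_format, of "2*n - 1"] by (simp add: exch_exp_def)
    show "x (2*n + 1) * x (2*n - 1) = 1 + x (2*n) ^ 4"
      using R[rule_format, of "2*n"] by (simp add: exch_exp_def)
  qed
qed

lemma cluster_sequence_ex1:
  "\<exists>!x :: int \<Rightarrow> ratfun2. x 0 = X0 \<and> x 1 = X1 \<and>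
     (\<forall>n. x (2*n) * x (2*n - 2) = 1 + x (2*n - 1)) \<and>
     (\<forall>n. x (2*n + 1) * x (2*n - 1) = 1 + x (2*n) ^ 4)"
  unfolding exchange_alt
proof -
  let ?F = "half_seq 1 4 X0 X1" and ?B = "half_seq 4 1 X1 X0"
  define z where "z k = (if 0 \<le> k then ?F (nat k) else ?B (nat (1 - k)))" for k :: int
  have zF: "z (int n) = ?F n" for n by (simp add: z_def)
  have zB: "z (1 - int n) = ?B n" for n
  proof (cases "n \<le> 1")
    case True
    then have "n = 0 \<or> n = Suc 0" by auto
    then show ?thesis by (auto simp: z_def)
  qed (simp add: z_def)
  have z: "z (k + 1) * z (k - 1) = 1 + z k ^ exch_exp k" for k
  proof (cases "1 \<le> k")
    case True
    then have k: "k = int (Suc (nat (k - 1)))" by simp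
    define n where "n = nat (k - 1)"
    have "k = int (Suc n)" using k n_def by simp
    then have "k + 1 = int (Suc (Suc n))" "k - 1 = int n" "k = int (Suc n)" by auto
    then show ?thesis
      using half_seq_rec[OF pos_ratfun_X0 pos_ratfun_X1, of 1 4 n]
      by (simp only: zF exch_exp_def) (auto split: if_splits)
  next
    case False
    define n where "n = nat (- k)"
    have "k = - int n" using False n_def by simp
    then have k: "k + 1 = 1 - int n" "k - 1 = 1 - int (Suc (Suc n))" "k = 1 - int (Suc n)"
      by auto
    have e: "exch_exp k = (if even n then 4 else 1)" using \<open>k = - int n\<close> by (simp add: exch_exp_def)
    show ?thesis
      using half_seq_rec[OF pos_ratfun_X1 pos_ratfun_X0, of 4 1 n]
      unfolding e k(1,2) unfolding k(3) zB by (simp only: mult.commute)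
  qed
  show "\<exists>!x :: int \<Rightarrow> ratfun2. x 0 = X0 \<and> x 1 = X1 \<and>
          (\<forall>k. x (k + 1) * x (k - 1) = 1 + x k ^ exch_exp k)"
  proof (rule ex1I[of _ z])
    show "z 0 = X0 \<and> z 1 = X1 \<and> (\<forall>k. z (k + 1) * z (k - 1) = 1 + z k ^ exch_exp k)"
      using z by (simp add: z_def)
  next
    fix x :: "int \<Rightarrow> ratfun2"
    assume x: "x 0 = X0 \<and> x 1 = X1 \<and> (\<forall>k. x (k + 1) * x (k - 1) = 1 + x k ^ exch_exp k)"
    have nz: "z k \<noteq> 0" for k
      unfolding z_def
      using pos_ratfun_nonzero pos_ratfun_half_seq pos_ratfun_X0 pos_ratfun_X1 by presburger
    have up: "x (k + 1) = z (k + 1)" if "x k = z k" "x (k - 1) = z (k - 1)" for k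
      using x z[of k] nz[of "k - 1"] that by (metis mult_right_cancel)
    have down: "x (k - 1) = z (k - 1)" if "x k = z k" "x (k + 1) = z (k + 1)" for k
      using x z[of k] nz[of "k + 1"] that by (metis mult_left_cancel)
    have base: "x 0 = z 0" "x 1 = z 1" using x by (simp_all add: z_def)
    have F: "x (int n) = z (int n) \<and> x (int n + 1) = z (int n + 1)" for n
    proof (induction n)
      case (Suc n)
      then show ?case using up[of "int n + 1"] by (simp add: add.commute)
    qed (use base in simp)
    have B: "x (- int n) = z (- int n) \<and> x (1 - int n) = z (1 - int n)" for n
    proof (induction n)
      case (Suc n)
      have "- int n + 1 = 1 - int n" "- int n - 1 = - int (Suc n)" "1 - int (Suc n) = - int n"
        by auto
      then show ?case using down[of "- int n"] Suc by metis
    qed (use base in simp)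
    show "x = z"
    proof
      fix k show "x k = z k"
        using F[of "nat k"] B[of "nat (- k)"] by (cases "0 \<le> k") auto
    qed
  qed
qed

end

theory Submission
  imports Defs
begin

text \<open>By the two exchange relations \<open>(x\<^sub>2\<^sub>n\<^sup>2 + x\<^sub>2\<^sub>n\<^sub>+\<^sub>2\<^sup>2) / x\<^sub>2\<^sub>n\<^sub>+\<^sub>1\<close> does not depend on \<open>n\<close>; calling it \<open>K\<close>,
  the even variables satisfy \<open>x\<^sub>2\<^sub>n\<^sub>+\<^sub>4 = K x\<^sub>2\<^sub>n\<^sub>+\<^sub>2 - x\<^sub>2\<^sub>n\<close>. Since \<open>y\<^sub>1 + y\<^sub>3 = K\<close> and \<open>y\<^sub>1 y\<^sub>3 - y\<^sub>2 = 1\<close>, this is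
  the recurrence of the coefficients of the continued fraction. Expanding the latter as a geometric
  series gives \<open>x\<^sub>2\<^sub>n\<close> as a sum of products \<open>y\<^sub>1\<^sup>p y\<^sub>2\<^sup>q y\<^sub>3\<^sup>l\<close>, and the binomial theorem then gives the
  Laurent expansions. For the odd variables, positivity needs a monomial of \<open>x\<^sub>2\<^sub>n\<close> whose inverse is
  a monomial of \<open>x\<^sub>2\<^sub>n\<^sub>+\<^sub>2\<close>.\<close>

subsection \<open>Continued fractions\<close>

text \<open>The factor \<open>fps_X\<close> pushes the k-th term of the geometric series to degree
  at least k. Hence \<open>g\<close> may have any constant term, and the sum stops at k = n.\<close>

lemma fps_inverse_one_minus_X_mult_nth:
  fixes g :: "'a::field fps"
  shows "inverse (1 - fps_X * g) $ n = (\<Sum>k\<le>n. (g ^ k) $ (n - k))"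
proof -
  let ?f = "fps_X * g"
  define I where "I = inverse (1 - ?f)"
  have unit: "I * (1 - ?f) = 1"
    unfolding I_def by (rule inverse_mult_eq_1) simp
  \<comment> \<open>The bracket is 1 by the finite geometric sum. After distributing, only the
    remainder still contains \<open>I\<close>; being a multiple of \<open>fps_X ^ Suc n\<close>, it
    does not reach the n-th coefficient.\<close>
  have "I = I * ((1 - ?f) * (\<Sum>k\<le>n. ?f ^ k) + ?f ^ Suc n)"
    by (simp only: sum_gp_basic) simp
  also have "\<dots> = (I * (1 - ?f)) * (\<Sum>k\<le>n. ?f ^ k) + I * ?f ^ Suc n"
    by (simp only: distrib_left mult.assoc)
  also have "\<dots> = (\<Sum>k\<le>n. ?f ^ k) + fps_X ^ Suc n * (g ^ Suc n * I)"
    unfolding unit by (simp only: power_mult_distrib mult_1_left mult_ac)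
  finally have I: "I = (\<Sum>k\<le>n. ?f ^ k) + fps_X ^ Suc n * (g ^ Suc n * I)" .
  have "I $ n = (\<Sum>k\<le>n. ?f ^ k) $ n"
    by (subst I) (simp add: fps_X_power_mult_nth del: power_Suc)
  also have "\<dots> = (\<Sum>k\<le>n. (g ^ k) $ (n - k))"
    by (simp add: fps_sum_nth power_mult_distrib fps_X_power_mult_nth)
  finally show ?thesis unfolding I_def .
qed

text \<open>For \<open>q = 0\<close> the truncated \<open>q + l - 1\<close> yields \<open>(0 choose 0) = 1\<close> and \<open>(l - 1 choose l) = 0\<close>, as
  required; this also matches the convention for \<open>multinom (-1)\<close>.\<close>

lemma fps_inverse_one_minus_X_const_power_nth:
  fixes c :: "'a::field"
  shows "(inverse (1 - fps_X * fps_const c) ^ q) $ l = of_nat ((q + l - 1) choose l) * c ^ l"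
proof (induction q arbitrary: l)
  case 0
  then show ?case by (cases l) (simp_all add: binomial_eq_0)
next
  case (Suc q)
  define H where "H = inverse (1 - fps_X * fps_const c) ^ Suc q"
  have "(1 - fps_X * fps_const c) * H = inverse (1 - fps_X * fps_const c) ^ q"
    using inverse_mult_eq_1'[of "1 - fps_X * fps_const c"]
    by (simp add: H_def flip: mult.assoc)
  \<comment> \<open>Read at degree l + 1, this is Pascal's rule: the first summand is known from the
    outer induction on q, the second from the inner one on l.\<close>
  then have H: "H = inverse (1 - fps_X * fps_const c) ^ q + fps_X * (fps_const c * H)"
    by (simp add: algebra_simps)
  have "H $ l = of_nat ((q + l) choose l) * c ^ l"
  proof (induction l)
    case 0
    show ?case by (subst H) (simp add: Suc.IH)
  next
    case (Suc l)
    show ?case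
      by (subst H) (simp add: Suc.IH \<open>\<And>l. (inverse (1 - fps_X * fps_const c) ^ q) $ l = _\<close>
          algebra_simps)
  qed
  then show ?case by (simp add: H_def)
qed

text \<open>The fraction has the form c / (1 - X g) with g = \<alpha> + X \<beta> / (1 - \<gamma>
  X). In the k-th power of g, q counts the factors contributing the second summand, and l is the
  degree taken from 1 / (1 - \<gamma> X)^q, so k + q + l = n.\<close>

lemma continued_fraction_nth:
  fixes c \<alpha> \<beta> \<gamma> :: "'a::field"
  shows "(fps_const c / (1 - fps_X * fps_const \<alpha>
            - fps_X ^ 2 * fps_const \<beta> / (1 - fps_X * fps_const \<gamma>))) $ n =
         (\<Sum>q\<le>n. \<Sum>l | 2 * q + l \<le> n. of_nat ((n - q - l) choose q)
            * of_nat ((q + l - 1) choose l) * (c * \<alpha> ^ (n - 2 * q - l) * \<beta> ^ q * \<gamma> ^ l))"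
proof -
  define G where "G = inverse (1 - fps_X * fps_const \<gamma>)"
  define g where "g = fps_X * (fps_const \<beta> * G) + fps_const \<alpha>"
  define t where "t k q = of_nat (k choose q) * \<alpha> ^ (k - q) * \<beta> ^ q
    * (of_nat ((n - k - 1) choose (n - k - q)) * \<gamma> ^ (n - k - q))" for k q
  have fin: "finite {l. 2 * q + l \<le> n}" for q
    by (rule finite_subset[of _ "{..n}"]) auto
  have denom: "1 - fps_X * fps_const \<alpha> - fps_X ^ 2 * fps_const \<beta> / (1 - fps_X * fps_const \<gamma>)
      = 1 - fps_X * g"
    by (simp add: fps_divide_unit g_def G_def algebra_simps power2_eq_square)
  have gk: "(g ^ k) $ (n - k) = (\<Sum>q | q \<le> k \<and> q \<le> n - k. t k q)" for k
  proof -
    have "(g ^ k) $ (n - k) = (\<Sum>q\<le>k. if q \<le> n - k then t k q else 0)"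
      unfolding g_def binomial_ring fps_sum_nth
    proof (rule sum.cong[OF refl])
      fix q assume "q \<in> {..k}"
      have "of_nat (k choose q) * (fps_X * (fps_const \<beta> * G)) ^ q * fps_const \<alpha> ^ (k - q)
          = fps_X ^ q * (fps_const (of_nat (k choose q) * \<beta> ^ q * \<alpha> ^ (k - q)) * G ^ q)"
        by (simp add: power_mult_distrib fps_of_nat[symmetric] fps_const_power mult_ac
            flip: fps_const_mult)
      moreover have "q + (n - k - q) - 1 = n - k - 1" if "q \<le> n - k"
        using that by simp
      ultimately show "(of_nat (k choose q) * (fps_X * (fps_const \<beta> * G)) ^ q * fps_const \<alpha> ^ (k - q)) $ (n - k)
          = (if q \<le> n - k then t k q else 0)"
        by (simp add: fps_X_power_mult_nth G_def fps_inverse_one_minus_X_const_power_nth t_def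
            mult_ac del: fps_const_mult diff_diff_left)
    qed
    also have "\<dots> = (\<Sum>q | q \<le> k \<and> q \<le> n - k. t k q)"
      by (simp add: sum.If_cases Int_def conj_commute)
    finally show ?thesis .
  qed
  have "(fps_const c / (1 - fps_X * g)) $ n = c * (\<Sum>k\<le>n. (g ^ k) $ (n - k))"
    by (simp add: fps_divide_unit fps_inverse_one_minus_X_mult_nth)
  also have "\<dots> = (\<Sum>(k, q)\<in>(SIGMA k:{..n}. {q. q \<le> k \<and> q \<le> n - k}). c * t k q)"
    by (simp add: gk sum.Sigma sum_distrib_left case_prod_unfold)
  \<comment> \<open>The index l = n - k - q replaces k; the bound q \<le> k becomes 2q + l \<le>
    n.\<close>
  also have "\<dots> = (\<Sum>(q, l)\<in>(SIGMA q:{..n}. {l. 2 * q + l \<le> n}). c * t (n - q - l) q)"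
    by (rule sum.reindex_bij_witness[of _ "\<lambda>(q, l). (n - q - l, q)" "\<lambda>(k, q). (q, n - k - q)"]) auto
  also have "\<dots> = (\<Sum>q\<le>n. \<Sum>l | 2 * q + l \<le> n. c * t (n - q - l) q)"
    using fin by (simp add: sum.Sigma)
  also have "\<dots> = (\<Sum>q\<le>n. \<Sum>l | 2 * q + l \<le> n. of_nat ((n - q - l) choose q)
            * of_nat ((q + l - 1) choose l) * (c * \<alpha> ^ (n - 2 * q - l) * \<beta> ^ q * \<gamma> ^ l))"
  proof (intro sum.cong refl)
    fix q l assume "l \<in> {l. 2 * q + l \<le> n}"
    then have "n - q - l - q = n - 2 * q - l" "n - (n - q - l) = q + l" "n - (n - q - l) - q = l"
      by auto
    then show "c * t (n - q - l) q = of_nat ((n - q - l) choose q)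
            * of_nat ((q + l - 1) choose l) * (c * \<alpha> ^ (n - 2 * q - l) * \<beta> ^ q * \<gamma> ^ l)"
      by (simp only: t_def mult_ac)
  qed
  finally show ?thesis unfolding denom .
qed

text \<open>Clearing both denominators gives c (1 - \<gamma> X) / (1 - (\<alpha> + \<gamma>) X +
  (\<alpha> \<gamma> - \<beta>) X^2). By \<open>det\<close> the last coefficient is 1, so the
  denominator encodes \<open>rec\<close>; the numerator encodes the two initial values.\<close>

lemma continued_fraction_of_recurrence:
  fixes c \<alpha> \<beta> \<gamma> :: "'a::field"
  assumes u0: "u 0 = c" and u1: "u (Suc 0) = \<alpha> * c"
    and rec: "\<And>n. u (Suc (Suc n)) = (\<alpha> + \<gamma>) * u (Suc n) - u n"
    and det: "\<alpha> * \<gamma> - \<beta> = 1"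
  shows "Abs_fps u = fps_const c / (1 - fps_X * fps_const \<alpha>
            - fps_X ^ 2 * fps_const \<beta> / (1 - fps_X * fps_const \<gamma>))"
proof -
  let ?E = "1 - fps_X * fps_const \<gamma>"
  let ?D = "1 - fps_X * fps_const \<alpha> - fps_X ^ 2 * fps_const \<beta> / ?E"
  have E0: "?E $ 0 \<noteq> 0" by simp
  have D0: "?D $ 0 \<noteq> 0" by (simp add: fps_divide_unit power2_eq_square mult.assoc)
  have "fps_X ^ 2 * fps_const \<beta> / ?E * ?E = fps_X ^ 2 * fps_const \<beta>"
    by (simp only: fps_divide_unit[OF E0] mult.assoc inverse_mult_eq_1[OF E0] mult_1_right)
  then have "?D * ?E = (1 - fps_X * fps_const \<alpha>) * ?E - fps_X ^ 2 * fps_const \<beta>"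
    by (simp only: left_diff_distrib)
  also have "\<dots> = 1 - fps_X * fps_const (\<alpha> + \<gamma>) + fps_X * (fps_X * fps_const (\<alpha> * \<gamma> - \<beta>))"
    by (simp add: algebra_simps power2_eq_square flip: fps_const_add fps_const_mult fps_const_sub)
  finally have DE: "?D * ?E = 1 - fps_X * fps_const (\<alpha> + \<gamma>) + fps_X * fps_X"
    by (simp add: det)
  have "Abs_fps u * (1 - fps_X * fps_const (\<alpha> + \<gamma>) + fps_X * fps_X) = fps_const c * ?E"
  proof (rule fps_ext)
    fix n
    have "Abs_fps u * (1 - fps_X * fps_const (\<alpha> + \<gamma>) + fps_X * fps_X) =
       Abs_fps u - fps_X * (fps_const (\<alpha> + \<gamma>) * Abs_fps u) + fps_X * (fps_X * Abs_fps u)"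
      by (simp add: algebra_simps)
    moreover have "fps_const c * ?E = fps_const c - fps_X * fps_const (c * \<gamma>)"
      by (simp add: algebra_simps flip: fps_const_mult)
    ultimately have *: "Abs_fps u * (1 - fps_X * fps_const (\<alpha> + \<gamma>) + fps_X * fps_X)
        = Abs_fps u - fps_X * (fps_const (\<alpha> + \<gamma>) * Abs_fps u) + fps_X * (fps_X * Abs_fps u)"
      "fps_const c * ?E = fps_const c - fps_X * fps_const (c * \<gamma>)"
      by blast+
    \<comment> \<open>Degrees 0 and 1 compare the initial values, all higher degrees the
      recurrence.\<close>
    consider "n = 0" | "n = 1" | k where "n = Suc (Suc k)"
      using not0_implies_Suc[of n] not0_implies_Suc[of "n - 1"] by fastforce
    then show "(Abs_fps u * (1 - fps_X * fps_const (\<alpha> + \<gamma>) + fps_X * fps_X)) $ n = (fps_const c * ?E) $ n"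
      unfolding *
      by cases (simp_all add: u0 u1 rec del: fps_const_add, simp_all add: algebra_simps)
  qed
  then have "(Abs_fps u * ?D) * ?E = fps_const c * ?E"
    by (simp only: mult.assoc DE)
  moreover have "?E \<noteq> 0" using E0 by (rule contrapos_nn) (simp only: fps_zero_nth)
  ultimately have "Abs_fps u * ?D = fps_const c" using mult_right_cancel by blast
  then have "fps_const c * inverse ?D = Abs_fps u * (?D * inverse ?D)"
    by (simp only: mult.assoc[symmetric])
  then show ?thesis
    by (simp only: fps_divide_unit[OF D0] inverse_mult_eq_1'[OF D0] mult_1_right)
qed

subsection \<open>Laurent expansions\<close>

lemma power_int_int_diff:
  "a \<noteq> 0 \<Longrightarrow> a powi (int m - int k) = a ^ m / (a ^ k :: 'a::field)"
  by (simp add: power_int_diff)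

section \<open>Multinomial coefficients and their supports\<close>

lemma multinom_posD:
  assumes "0 < multinom N ms"
  shows "(\<forall>m\<in>set ms. 0 \<le> m) \<and> (sum_list ms \<le> N \<or> N = -1 \<and> (\<forall>m\<in>set ms. m = 0))"
  using assms unfolding multinom_def by (fastforce split: if_splits)

lemma multinom_1: "multinom (int N) [int m] = N choose m"
  by (auto simp: multinom_def binomial_fact' nat_diff_distrib)

text \<open>Choosing the a + b objects first isolates a factor depending only on N and a + b. For a
  = q - r and b = r it is constant in r, and the other factor is ready for the binomial
  theorem.\<close>

lemma multinom_2:
  assumes "a + b \<le> N"
  shows "multinom (int N) [int a, int b] = (N choose (a + b)) * ((a + b) choose b)"
proof -
  have ab: "fact b * fact a * ((a + b) choose b) = (fact (a + b) :: nat)"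
    using binomial_fact_lemma[of b "a + b"] by simp
  have N: "fact (a + b) * fact (N - (a + b)) * (N choose (a + b)) = (fact N :: nat)"
    using binomial_fact_lemma assms by blast
  have "(fact N :: nat) =
      ((N choose (a + b)) * ((a + b) choose b)) * (fact a * (fact b * fact (N - (a + b))))"
    by (simp only: N[symmetric] ab[symmetric] mult_ac)
  moreover have "nat (int N - (int a + int b)) = N - (a + b)" by simp
  ultimately show ?thesis using assms by (simp add: multinom_def mult.assoc)
qed

text \<open>The third class is chosen from what the first two leave, so for fixed a + b the sums
  over b and over c separate.\<close>

lemma multinom_3:
  assumes "a + b + c \<le> N"
  shows "multinom (int N) [int a, int b, int c] =
    (N choose (a + b)) * ((a + b) choose b) * ((N - (a + b)) choose c)"
proof -
  have ab: "fact b * fact a * ((a + b) choose b) = (fact (a + b) :: nat)"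
    using binomial_fact_lemma[of b "a + b"] by simp
  have N: "fact (a + b) * fact (N - (a + b)) * (N choose (a + b)) = (fact N :: nat)"
    using binomial_fact_lemma assms by auto
  have c: "fact c * fact (N - (a + b + c)) * ((N - (a + b)) choose c) = (fact (N - (a + b)) :: nat)"
    using binomial_fact_lemma[of c "N - (a + b)"] assms by (simp add: add.assoc)
  have "(fact N :: nat) =
      ((N choose (a + b)) * ((a + b) choose b) * ((N - (a + b)) choose c))
      * (fact a * (fact b * (fact c * fact (N - (a + b + c)))))"
    by (simp only: N[symmetric] ab[symmetric] c[symmetric] mult_ac)
  moreover have "nat (int N - (int a + (int b + int c))) = N - (a + b + c)" by simp
  ultimately show ?thesis using assms by (simp add: multinom_def mult.assoc add.assoc)
qed

lemma finite_le_nat_combination: "finite {l. 2 * q + l \<le> (n::nat)}"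
  by (rule finite_subset[of _ "{..n}"]) auto

text \<open>The ranges only have to contain the support of \<open>g\<close>. Iterated finite sums
  allow the binomial theorem to be applied to one index at a time.\<close>

lemma Sum_any_Sigma5:
  fixes g :: "nat \<times> nat \<times> nat \<times> nat \<times> nat \<Rightarrow> 'a::comm_monoid_add"
  assumes "\<And>q l. finite (L q)" and "finite Q" and "\<And>q l. finite (R q l)"
    and "\<And>q l r. finite (S q l r)" and "\<And>q l r s. finite (M q l r s)"
    and "\<And>q l r s m. g (q, l, r, s, m) \<noteq> 0 \<Longrightarrow>
           q \<in> Q \<and> l \<in> L q \<and> r \<in> R q l \<and> s \<in> S q l r \<and> m \<in> M q l r s"
  shows "Sum_any g =
    (\<Sum>q\<in>Q. \<Sum>l\<in>L q. \<Sum>r\<in>R q l. \<Sum>s\<in>S q l r. \<Sum>m\<in>M q l r s. g (q, l, r, s, m))"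
proof -
  let ?A = "SIGMA q:Q. SIGMA l:L q. SIGMA r:R q l. SIGMA s:S q l r. M q l r s"
  have "Sum_any g = sum g ?A"
    using assms by (intro Sum_any.expand_superset) auto
  also have "\<dots> = (\<Sum>q\<in>Q. \<Sum>l\<in>L q. \<Sum>r\<in>R q l. \<Sum>s\<in>S q l r. \<Sum>m\<in>M q l r s. g (q, l, r, s, m))"
    using assms by (simp add: sum.Sigma split_def)
  finally show ?thesis .
qed

lemma sum_binomial_powers: "(\<Sum>m\<le>N. of_nat (N choose m) * z ^ m) = (1 + z :: 'a::comm_semiring_1) ^ N"
  using binomial_ring[of z 1 N] by (simp add: add.commute)

lemma multinom_pred_1: "multinom (int q + int l - 1) [int l] = (q + l - 1) choose l"
proof (cases "q + l = 0")
  case True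
  then show ?thesis by (simp add: multinom_def)
next
  case False
  then have "int q + int l - 1 = int (q + l - 1)" by linarith
  then show ?thesis by (simp only: multinom_1)
qed

text \<open>For q = 0 < l both sides vanish, as l objects cannot be chosen from l - 1. For q = l = 0
  both are 1: the left by the exceptional value at -1, the right by truncated subtraction.\<close>

lemma multinom_pred_2:
  assumes "l = a + b"
  shows "multinom (int q + int l - 1) [int a, int b] = ((q + l - 1) choose l) * (l choose b)"
proof -
  consider "q = 0" "l = 0" | "q = 0" "0 < l" | "0 < q" by blast
  then show ?thesis
  proof cases
    case 1
    then show ?thesis using assms by (simp add: multinom_def)
  next
    case 2
    then have "\<not> 0 < multinom (int q + int l - 1) [int a, int b]"
      using multinom_posD[of "int q + int l - 1" "[int a, int b]"] assms by auto
    then show ?thesis using 2 by (simp add: binomial_eq_0)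
  next
    case 3
    then have "int q + int l - 1 = int (q + l - 1)" "a + b \<le> q + l - 1"
      using assms by linarith+
    then show ?thesis by (simp only: multinom_2 assms)
  qed
qed

text \<open>The exceptional value of the first factor would need q = 0 and l = n + 1, but then the
  second factor vanishes. Hence 2q + l \<le> n, which makes the upper entry of the third factor
  non-negative and excludes the exception there too.\<close>

lemma multinom_support_0:
  assumes "0 < multinom (int n - int q - int l) [int q - int r, int r]"
    and "0 < multinom (int q + int l - 1) [int l - int s, int s]"
    and "0 < multinom (int n + 2 * int r + int s - 2 * int q - int l) [int m]"
  shows "q \<le> n \<and> 2 * q + l \<le> n \<and> r \<le> q \<and> s \<le> l \<and> m \<le> n + 2 * r + s - 2 * q - l"
proof -
  note 1 = assms[THEN multinom_posD]
  have "r \<le> q" "s \<le> l" using 1(1,2) by simp_all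
  moreover have "2 * q + l \<le> n" using 1(1,2) by simp linarith
  moreover have "int m \<le> int n + 2 * int r + int s - 2 * int q - int l"
    using 1(3) \<open>2 * q + l \<le> n\<close> by simp
  ultimately show ?thesis by linarith
qed

lemma multinom_support_1:
  assumes "0 < multinom (int n - int q - int l) [int q - int r, int r, int s]"
    and "0 < multinom (int q + int l - 1) [int l]"
    and "0 < multinom (2 * int r + int s + int l) [int m]"
  shows "q \<le> n \<and> 2 * q + l \<le> n \<and> r \<le> q \<and> s \<le> n - 2 * q - l \<and> m \<le> 2 * r + s + l"
proof -
  note 1 = assms[THEN multinom_posD]
  have "r \<le> q" using 1(1) by simp
  moreover have "2 * q + l + s \<le> n" using 1(1,2) by simp linarith
  moreover have "m \<le> 2 * r + s + l"
    using 1(3) by simp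
  ultimately show ?thesis by linarith
qed

text \<open>With A = 1 + b, the index r expands (A^2 + a^4)^q from \<beta>^q and s expands (A +
  a^4)^l from \<gamma>^l. Together with \<alpha>^p, where p = n - 2q - l, this collects A^(p + 2r +
  s), which m expands in powers of b.\<close>

lemma Laurent_expansion_0:
  fixes a b :: "'a::field"
  assumes a: "a \<noteq> 0" and b: "b \<noteq> 0"
    and \<alpha>: "\<alpha> = (1 + b) / a ^ 2"
    and \<beta>: "\<beta> = (a ^ 4 + (1 + b) ^ 2) / (a ^ 4 * b)"
    and \<gamma>: "\<gamma> = (a ^ 4 + 1 + b) / (a ^ 2 * b)"
  shows "(\<Sum>q\<le>n. \<Sum>l | 2 * q + l \<le> n. of_nat ((n - q - l) choose q)
            * of_nat ((q + l - 1) choose l) * (a * \<alpha> ^ (n - 2 * q - l) * \<beta> ^ q * \<gamma> ^ l)) =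
    Sum_any (\<lambda>(q::nat, l::nat, r::nat, s::nat, m::nat).
           a powi (1 + 4 * (int q + int l) - 2 * int n - 4 * (int r + int s))
           * b powi (int m - int q - int l)
           * of_nat (multinom (int n - int q - int l) [int q - int r, int r])
           * of_nat (multinom (int q + int l - 1) [int l - int s, int s])
           * of_nat (multinom (int n + 2 * int r + int s - 2 * int q - int l) [int m]))"
    (is "?lhs = Sum_any (\<lambda>(q, l, r, s, m). ?t q l r s m)")
proof (subst Sum_any_Sigma5[where Q = "{..n}" and L = "\<lambda>q. {l. 2 * q + l \<le> n}" and R = "\<lambda>q l. {..q}"
        and S = "\<lambda>q l r. {..l}" and M = "\<lambda>q l r s. {..n + 2 * r + s - 2 * q - l}"])
  show "q \<in> {..n} \<and> l \<in> {l. 2 * q + l \<le> n} \<and> r \<in> {..q} \<and> s \<in> {..l} \<and> m \<in> {..n + 2 * r + s - 2 * q - l}"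
    if "(case (q, l, r, s, m) of (q, l, r, s, m) \<Rightarrow> ?t q l r s m) \<noteq> 0"
    for q l r s m
  proof -
    have "0 < multinom (int n - int q - int l) [int q - int r, int r]"
      "0 < multinom (int q + int l - 1) [int l - int s, int s]"
      "0 < multinom (int n + 2 * int r + int s - 2 * int q - int l) [int m]"
      using that by - (rule gr0I, simp)+
    from multinom_support_0[OF this] show ?thesis by simp
  qed
next
  define A where "A = 1 + b"
  have "(\<Sum>r\<le>q. \<Sum>s\<le>l. \<Sum>m\<le>n + 2 * r + s - 2 * q - l. ?t q l r s m)
      = of_nat ((n - q - l) choose q) * of_nat ((q + l - 1) choose l)
            * (a * \<alpha> ^ (n - 2 * q - l) * \<beta> ^ q * \<gamma> ^ l)" (is "?L = ?R")
    if ql: "2 * q + l \<le> n" for q l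
  proof -
    define p where "p = n - 2 * q - l"
    have n: "n = p + 2 * q + l" using ql by (simp add: p_def)
    \<comment> \<open>Everything that does not depend on r, s or m.\<close>
    define c where "c = of_nat ((p + q) choose q) * of_nat ((q + l - 1) choose l)
      * (a * A ^ p / (a ^ (2 * p + 4 * q + 2 * l) * b ^ (q + l)))"
    have "?L = (\<Sum>r\<le>q. \<Sum>s\<le>l. c * (of_nat (q choose r) * (A ^ 2) ^ r * (a ^ 4) ^ (q - r))
        * (of_nat (l choose s) * A ^ s * (a ^ 4) ^ (l - s)))"
    proof (intro sum.cong refl)
      fix r s assume "r \<in> {..q}" "s \<in> {..l}"
      then obtain q' l' where q: "q = q' + r" and l: "l = l' + s"
        by (metis atMost_iff le_Suc_ex add.commute)
      have m1: "multinom (int n - int q - int l) [int q - int r, int r] = ((p + q) choose q) * (q choose r)"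
        using multinom_2[of q' r "p + q"] by (simp add: n q algebra_simps)
      have m2: "multinom (int q + int l - 1) [int l - int s, int s] = ((q + l - 1) choose l) * (l choose s)"
        using multinom_pred_2[OF l, of q] by (simp add: l)
      have pa: "a powi (1 + 4 * (int q + int l) - 2 * int n - 4 * (int r + int s))
          = a * (a ^ 4) ^ q' * (a ^ 4) ^ l' / a ^ (2 * p + 4 * q + 2 * l)"
      proof -
        \<comment> \<open>Splitting the exponent into a difference of naturals turns
          \<open>powi\<close> into a quotient of ordinary powers; n = p + 2q + l, q = q' + r and l =
          l' + s are substituted.\<close>
        have "1 + 4 * (int q + int l) - 2 * int n - 4 * (int r + int s)
            = int (1 + 4 * q' + 4 * l') - int (2 * p + 4 * q + 2 * l)"
          by (simp add: n q l)
        then show ?thesis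
          by (simp only: power_int_int_diff[OF a] power_add power_mult power_one_right)
      qed
      have pb: "b powi (int m - int q - int l) = b ^ m / b ^ (q + l)" for m
        using power_int_int_diff[OF b, of m "q + l"] by (simp add: diff_diff_eq)
      have N: "int n + 2 * int r + int s - 2 * int q - int l = int (p + 2 * r + s)"
        "n + 2 * r + s - 2 * q - l = p + 2 * r + s"
        by (simp_all add: n)
      show "(\<Sum>m\<le>n + 2 * r + s - 2 * q - l. ?t q l r s m)
        = c * (of_nat (q choose r) * (A ^ 2) ^ r * (a ^ 4) ^ (q - r))
           * (of_nat (l choose s) * A ^ s * (a ^ 4) ^ (l - s))" (is "?S = _")
      proof -
        have "?S = (\<Sum>m\<le>p + 2 * r + s. (a * (a ^ 4) ^ q' * (a ^ 4) ^ l' / a ^ (2 * p + 4 * q + 2 * l)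
             / b ^ (q + l) * of_nat ((p + q) choose q) * of_nat (q choose r)
             * of_nat ((q + l - 1) choose l) * of_nat (l choose s))
             * (of_nat ((p + 2 * r + s) choose m) * b ^ m))"
          unfolding pa pb m1 m2 N multinom_1
          by (simp only: of_nat_mult divide_inverse mult_ac)
        also have "\<dots> = (a * (a ^ 4) ^ q' * (a ^ 4) ^ l' / a ^ (2 * p + 4 * q + 2 * l)
             / b ^ (q + l) * of_nat ((p + q) choose q) * of_nat (q choose r)
             * of_nat ((q + l - 1) choose l) * of_nat (l choose s)) * A ^ (p + 2 * r + s)"
          by (simp only: sum_distrib_left[symmetric] sum_binomial_powers A_def)
        also have "\<dots> = c * (of_nat (q choose r) * (A ^ 2) ^ r * (a ^ 4) ^ (q - r))
           * (of_nat (l choose s) * A ^ s * (a ^ 4) ^ (l - s))"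
        proof -
          have "q - r = q'" "l - s = l'" by (simp_all add: q l)
          then show ?thesis
            by (simp only: c_def power_add power_mult[symmetric] divide_inverse inverse_mult_distrib mult_ac)
        qed
        finally show ?thesis .
      qed
    qed
    also have "\<dots> = c * (A ^ 2 + a ^ 4) ^ q * (A + a ^ 4) ^ l"
      by (simp only: binomial_ring sum_distrib_left[symmetric] sum_distrib_right[symmetric])
    also have "\<dots> = ?R"
    proof -
      have "n - q - l = p + q" by (simp add: n)
      moreover have "\<alpha> ^ p = A ^ p / a ^ (2 * p)"
        by (simp only: \<alpha> A_def power_divide power_mult)
      moreover have "\<beta> ^ q = (A ^ 2 + a ^ 4) ^ q / (a ^ (4 * q) * b ^ q)"
        by (simp only: \<beta> A_def power_divide power_mult power_mult_distrib add.commute)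
      moreover have "\<gamma> ^ l = (A + a ^ 4) ^ l / (a ^ (2 * l) * b ^ l)"
        by (simp only: \<gamma> A_def power_divide power_mult power_mult_distrib add_ac)
      ultimately show ?thesis unfolding p_def[symmetric]
        by (simp only: c_def power_add divide_inverse inverse_mult_distrib mult_ac)
    qed
    finally show ?thesis .
  qed
  then show "?lhs =
     (\<Sum>q\<le>n. \<Sum>l | 2 * q + l \<le> n. \<Sum>r\<le>q. \<Sum>s\<le>l. \<Sum>m\<le>n + 2 * r + s - 2 * q - l.
       (case (q, l, r, s, m) of (q, l, r, s, m) \<Rightarrow> ?t q l r s m))"
    by (intro sum.cong refl) simp
qed (auto simp: finite_le_nat_combination)

text \<open>Compared with \<open>Laurent_expansion_0\<close>, \<alpha> and \<gamma> change roles: s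
  now expands \<alpha>^p, whose binomial coefficient is absorbed into the three-part multinomial,
  and \<gamma>^l contributes A^l, so m expands A^(l + 2r + s).\<close>

lemma Laurent_expansion_1:
  fixes a b :: "'a::field"
  assumes a: "a \<noteq> 0" and b: "b \<noteq> 0"
    and \<alpha>: "\<alpha> = (a ^ 4 + 1 + b) / (a ^ 2 * b)"
    and \<beta>: "\<beta> = (a ^ 4 + (1 + b) ^ 2) / (a ^ 4 * b)"
    and \<gamma>: "\<gamma> = (1 + b) / a ^ 2"
  shows "(\<Sum>q\<le>n. \<Sum>l | 2 * q + l \<le> n. of_nat ((n - q - l) choose q)
            * of_nat ((q + l - 1) choose l) * (a * \<alpha> ^ (n - 2 * q - l) * \<beta> ^ q * \<gamma> ^ l)) =
    Sum_any (\<lambda>(q::nat, l::nat, r::nat, s::nat, m::nat).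
           a powi (1 + 2 * int n - 4 * (int q + int l + int r + int s))
           * b powi (int q + int l + int m - int n)
           * of_nat (multinom (int n - int q - int l) [int q - int r, int r, int s])
           * of_nat (multinom (int q + int l - 1) [int l])
           * of_nat (multinom (2 * int r + int s + int l) [int m]))"
    (is "?lhs = Sum_any (\<lambda>(q, l, r, s, m). ?t q l r s m)")
proof (subst Sum_any_Sigma5[where Q = "{..n}" and L = "\<lambda>q. {l. 2 * q + l \<le> n}" and R = "\<lambda>q l. {..q}"
        and S = "\<lambda>q l r. {..n - 2 * q - l}" and M = "\<lambda>q l r s. {..2 * r + s + l}"])
  show "q \<in> {..n} \<and> l \<in> {l. 2 * q + l \<le> n} \<and> r \<in> {..q} \<and> s \<in> {..n - 2 * q - l} \<and> m \<in> {..2 * r + s + l}"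
    if "(case (q, l, r, s, m) of (q, l, r, s, m) \<Rightarrow> ?t q l r s m) \<noteq> 0"
    for q l r s m
  proof -
    have "0 < multinom (int n - int q - int l) [int q - int r, int r, int s]"
      "0 < multinom (int q + int l - 1) [int l]"
      "0 < multinom (2 * int r + int s + int l) [int m]"
      using that by - (rule gr0I, simp)+
    from multinom_support_1[OF this] show ?thesis by simp
  qed
next
  define A where "A = 1 + b"
  have "(\<Sum>r\<le>q. \<Sum>s\<le>n - 2 * q - l. \<Sum>m\<le>2 * r + s + l. ?t q l r s m)
      = of_nat ((n - q - l) choose q) * of_nat ((q + l - 1) choose l)
            * (a * \<alpha> ^ (n - 2 * q - l) * \<beta> ^ q * \<gamma> ^ l)" (is "?L = ?R")
    if ql: "2 * q + l \<le> n" for q l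
  proof -
    define p where "p = n - 2 * q - l"
    have n: "n = p + 2 * q + l" using ql by (simp add: p_def)
    define c where "c = of_nat ((p + q) choose q) * of_nat ((q + l - 1) choose l)
      * (a * A ^ l / (a ^ (2 * p + 4 * q + 2 * l) * b ^ (p + q)))"
    have "?L = (\<Sum>r\<le>q. \<Sum>s\<le>p. c * (of_nat (q choose r) * (A ^ 2) ^ r * (a ^ 4) ^ (q - r))
        * (of_nat (p choose s) * A ^ s * (a ^ 4) ^ (p - s)))"
      unfolding p_def[symmetric]
    proof (intro sum.cong refl)
      fix r s assume "r \<in> {..q}" "s \<in> {..p}"
      then obtain q' p' where q: "q = q' + r" and p: "p = p' + s"
        by (metis atMost_iff le_Suc_ex add.commute)
      have m1: "multinom (int n - int q - int l) [int q - int r, int r, int s]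
          = ((p + q) choose q) * (q choose r) * (p choose s)"
        using multinom_3[of q' r s "p + q"] by (simp add: n q p algebra_simps)
      have pa: "a powi (1 + 2 * int n - 4 * (int q + int l + int r + int s))
          = a * (a ^ 4) ^ q' * (a ^ 4) ^ p' / a ^ (2 * p + 4 * q + 2 * l)"
      proof -
        have "1 + 2 * int n - 4 * (int q + int l + int r + int s)
            = int (1 + 4 * q' + 4 * p') - int (2 * p + 4 * q + 2 * l)"
          by (simp add: n q p)
        then show ?thesis
          by (simp only: power_int_int_diff[OF a] power_add power_mult power_one_right)
      qed
      have pb: "b powi (int q + int l + int m - int n) = b ^ m / b ^ (p + q)" for m
      proof -
        have "int q + int l + int m - int n = int m - int (p + q)" by (simp add: n)
        then show ?thesis by (simp only: power_int_int_diff[OF b])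
      qed
      have N: "2 * int r + int s + int l = int (l + 2 * r + s)" "2 * r + s + l = l + 2 * r + s"
        by simp_all
      show "(\<Sum>m\<le>2 * r + s + l. ?t q l r s m)
        = c * (of_nat (q choose r) * (A ^ 2) ^ r * (a ^ 4) ^ (q - r))
           * (of_nat (p choose s) * A ^ s * (a ^ 4) ^ (p - s))" (is "?S = _")
      proof -
        have "?S = (\<Sum>m\<le>l + 2 * r + s. (a * (a ^ 4) ^ q' * (a ^ 4) ^ p' / a ^ (2 * p + 4 * q + 2 * l)
             / b ^ (p + q) * of_nat ((p + q) choose q) * of_nat (q choose r)
             * of_nat ((q + l - 1) choose l) * of_nat (p choose s))
             * (of_nat ((l + 2 * r + s) choose m) * b ^ m))"
          unfolding pa pb m1 multinom_pred_1 N multinom_1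
          by (simp only: of_nat_mult divide_inverse mult_ac)
        also have "\<dots> = (a * (a ^ 4) ^ q' * (a ^ 4) ^ p' / a ^ (2 * p + 4 * q + 2 * l)
             / b ^ (p + q) * of_nat ((p + q) choose q) * of_nat (q choose r)
             * of_nat ((q + l - 1) choose l) * of_nat (p choose s)) * A ^ (l + 2 * r + s)"
          by (simp only: sum_distrib_left[symmetric] sum_binomial_powers A_def)
        also have "\<dots> = c * (of_nat (q choose r) * (A ^ 2) ^ r * (a ^ 4) ^ (q - r))
           * (of_nat (p choose s) * A ^ s * (a ^ 4) ^ (p - s))"
        proof -
          have "q - r = q'" "p - s = p'" by (simp_all add: q p)
          then show ?thesis
            by (simp only: c_def power_add power_mult[symmetric] divide_inverse inverse_mult_distrib mult_ac)
        qed
        finally show ?thesis .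
      qed
    qed
    also have "\<dots> = c * (A ^ 2 + a ^ 4) ^ q * (A + a ^ 4) ^ p"
      by (simp only: binomial_ring sum_distrib_left[symmetric] sum_distrib_right[symmetric])
    also have "\<dots> = ?R"
    proof -
      have "n - q - l = p + q" by (simp add: n)
      moreover have "\<alpha> ^ p = (A + a ^ 4) ^ p / (a ^ (2 * p) * b ^ p)"
        by (simp only: \<alpha> A_def power_divide power_mult power_mult_distrib add_ac)
      moreover have "\<beta> ^ q = (A ^ 2 + a ^ 4) ^ q / (a ^ (4 * q) * b ^ q)"
        by (simp only: \<beta> A_def power_divide power_mult power_mult_distrib add.commute)
      moreover have "\<gamma> ^ l = A ^ l / a ^ (2 * l)"
        by (simp only: \<gamma> A_def power_divide power_mult)
      ultimately show ?thesis unfolding p_def[symmetric]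
        by (simp only: c_def power_add divide_inverse inverse_mult_distrib mult_ac)
    qed
    finally show ?thesis .
  qed
  then show "?lhs =
     (\<Sum>q\<le>n. \<Sum>l | 2 * q + l \<le> n. \<Sum>r\<le>q. \<Sum>s\<le>n - 2 * q - l. \<Sum>m\<le>2 * r + s + l.
       (case (q, l, r, s, m) of (q, l, r, s, m) \<Rightarrow> ?t q l r s m))"
    by (intro sum.cong refl) simp
qed (auto simp: finite_le_nat_combination)

subsection \<open>Laurent polynomials with non-negative coefficients\<close>

text \<open>Coefficients arise by adding the same monomial repeatedly. This gives closure under
  products by induction, without convolving coefficient functions.\<close>

inductive_set nonneg_Laurent :: "'a::field \<Rightarrow> 'a \<Rightarrow> 'a set" for a b :: 'a where
  zero: "0 \<in> nonneg_Laurent a b"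
| add_monom: "f \<in> nonneg_Laurent a b \<Longrightarrow> f + a powi i * b powi j \<in> nonneg_Laurent a b"

lemma nonneg_Laurent_imp_nonneg_int_Laurent_in:
  assumes "f \<in> nonneg_Laurent a b"
  shows "nonneg_int_Laurent_in a b f"
  using assms
proof induction
  case zero
  show ?case
    unfolding nonneg_int_Laurent_in_def by (rule exI[of _ "\<lambda>_. 0"]) simp
next
  case (add_monom f i0 j0)
  define M where "M = (\<lambda>(i, j). a powi i * b powi j)"
  from add_monom.IH obtain c :: "int \<times> int \<Rightarrow> nat" where fin: "finite {k. c k \<noteq> 0}"
    and f: "f = (\<Sum>k | c k \<noteq> 0. of_nat (c k) * M k)"
    unfolding nonneg_int_Laurent_in_def M_def by (auto simp: split_def mult.assoc)
  define k0 where "k0 = (i0, j0)"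
  define d where "d = c(k0 := Suc (c k0))"
  let ?A = "insert k0 {k. c k \<noteq> 0}"
  have supp: "{k. d k \<noteq> 0} = ?A" by (auto simp: d_def)
  \<comment> \<open>The old sum is padded to the new support, where only the coefficient at
    \<open>k0\<close> differs.\<close>
  have "f = (\<Sum>k\<in>?A. of_nat (c k) * M k)"
    unfolding f using fin by (intro sum.mono_neutral_left) auto
  then have "f + M k0 = (\<Sum>k\<in>?A. of_nat (c k) * M k) + (\<Sum>k\<in>?A. if k = k0 then M k else 0)"
    using fin by simp
  also have "\<dots> = (\<Sum>k | d k \<noteq> 0. of_nat (d k) * M k)"
    unfolding supp sum.distrib[symmetric]
    by (rule sum.cong) (auto simp: d_def algebra_simps)
  finally show ?case
    unfolding nonneg_int_Laurent_in_def using fin supp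
    by (intro exI[of _ d]) (auto simp: M_def k0_def split_def mult.assoc)
qed

lemma nonneg_Laurent_commute: "nonneg_Laurent a b = nonneg_Laurent b a"
proof -
  have "f \<in> nonneg_Laurent b a" if "f \<in> nonneg_Laurent a b" for a b f :: 'a
    using that
  proof induction
    case (add_monom f i j)
    then show ?case
      using nonneg_Laurent.add_monom[of f b a j i] by (simp add: mult.commute)
  qed (rule nonneg_Laurent.zero)
  then show ?thesis by blast
qed

lemma nonneg_Laurent_add:
  assumes "f \<in> nonneg_Laurent a b" "g \<in> nonneg_Laurent a b"
  shows "f + g \<in> nonneg_Laurent a b"
  using assms(2)
  by induction (use assms(1) in \<open>auto simp flip: add.assoc intro: nonneg_Laurent.intros\<close>)

lemma nonneg_Laurent_sum:
  "(\<And>i. i \<in> I \<Longrightarrow> f i \<in> nonneg_Laurent a b) \<Longrightarrow> sum f I \<in> nonneg_Laurent a b"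
  by (induction I rule: infinite_finite_induct)
     (auto intro: nonneg_Laurent.zero nonneg_Laurent_add)

lemma nonneg_Laurent_monom: "a powi i * b powi j \<in> nonneg_Laurent a b"
  using nonneg_Laurent.add_monom[OF nonneg_Laurent.zero] by simp

lemma nonneg_Laurent_mult_monom:
  assumes "a \<noteq> 0" "b \<noteq> 0" "f \<in> nonneg_Laurent a b"
  shows "f * (a powi i * b powi j) \<in> nonneg_Laurent a b"
  using assms(3)
proof induction
  case zero
  show ?case by (simp add: nonneg_Laurent.zero)
next
  case (add_monom f i' j')
  have "(f + a powi i' * b powi j') * (a powi i * b powi j)
      = f * (a powi i * b powi j) + a powi (i' + i) * b powi (j' + j)"
    using assms by (simp add: power_int_add algebra_simps)
  then show ?case using add_monom.IH by (auto intro: nonneg_Laurent.intros)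
qed

lemma nonneg_Laurent_mult:
  assumes "a \<noteq> 0" "b \<noteq> 0" "f \<in> nonneg_Laurent a b" "g \<in> nonneg_Laurent a b"
  shows "f * g \<in> nonneg_Laurent a b"
  using assms(4)
  by induction
    (auto simp: distrib_left intro!: nonneg_Laurent.zero nonneg_Laurent_add
      nonneg_Laurent_mult_monom assms(1-3))

lemma nonneg_Laurent_gens:
  "1 \<in> nonneg_Laurent a b" "a \<in> nonneg_Laurent a b" "b \<in> nonneg_Laurent a b"
  "inverse a \<in> nonneg_Laurent a b" "inverse b \<in> nonneg_Laurent a b"
  using nonneg_Laurent_monom[of a 0 b 0] nonneg_Laurent_monom[of a 1 b 0]
    nonneg_Laurent_monom[of a 0 b 1] nonneg_Laurent_monom[of a "-1" b 0]
    nonneg_Laurent_monom[of a 0 b "-1"]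
  by (simp_all add: power_int_minus)

section \<open>The order defined by the cone of non-negative Laurent expressions\<close>

context
  fixes a b :: "'a::field"
  assumes nz: "a \<noteq> 0" "b \<noteq> 0"
begin

private abbreviation "P \<equiv> nonneg_Laurent a b"

lemma nonneg_Laurent_power: "f \<in> P \<Longrightarrow> f ^ n \<in> P"
  by (induction n) (auto intro: nonneg_Laurent_gens nonneg_Laurent_mult[OF nz])

lemma nonneg_Laurent_of_nat: "of_nat n \<in> P"
  by (induction n) (auto intro: nonneg_Laurent_gens nonneg_Laurent_add nonneg_Laurent.zero)

lemmas nonneg_Laurent_closed = nonneg_Laurent_gens[where a = a and b = b] nonneg_Laurent_add[of _ a b]
  nonneg_Laurent_mult[OF nz] nonneg_Laurent_power nonneg_Laurent_of_nat

text \<open>Monotonicity of products in this order, by the telescoping that keeps every factor in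
  the cone.\<close>

lemma nonneg_Laurent_diff_mult:
  assumes "f - f' \<in> P" "g - g' \<in> P" "f' \<in> P" "g \<in> P"
  shows "f * g - f' * g' \<in> P"
proof -
  have "f * g - f' * g' = (f - f') * g + f' * (g - g')" by (simp add: algebra_simps)
  then show ?thesis using assms by (simp add: nonneg_Laurent_closed)
qed

lemma nonneg_Laurent_diff_power:
  assumes "f - f' \<in> P" "f \<in> P" "f' \<in> P"
  shows "f ^ n - f' ^ n \<in> P"
  by (induction n)
    (auto intro!: nonneg_Laurent.zero nonneg_Laurent_diff_mult nonneg_Laurent_power assms)

text \<open>Reading \<open>f - f' \<in> P\<close> as \<open>f \<ge> f'\<close>: the coefficient of \<open>t\<^sup>n\<close> dominates both its summand
  for \<open>q = l = 0\<close> and its summand for \<open>q = 1\<close>, \<open>l = n - 2\<close>. Monomials in these with product 1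
  account for the constant term that is subtracted.\<close>

lemma nonneg_Laurent_consecutive_product_minus_1:
  assumes coeff: "\<And>n. u n = (\<Sum>q\<le>n. \<Sum>l | 2 * q + l \<le> n. of_nat ((n - q - l) choose q)
            * of_nat ((q + l - 1) choose l) * (c * \<alpha> ^ (n - 2 * q - l) * \<beta> ^ q * \<gamma> ^ l))"
    and P: "c \<in> P" "\<alpha> \<in> P" "\<beta> \<in> P" "\<gamma> \<in> P" "\<alpha>' \<in> P" "\<beta>' \<in> P" "\<gamma>' \<in> P"
    and ge: "\<alpha> - \<alpha>' \<in> P" "\<beta> - \<beta>' \<in> P" "\<gamma> - \<gamma>' \<in> P"
    and prod: "(c * \<alpha>' ^ Suc k) * (c * \<beta>' * \<gamma>' ^ k) = 1"
  shows "u (Suc k) * u (Suc (Suc k)) - 1 \<in> P"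
proof -
  define t where "t n q l = of_nat ((n - q - l) choose q)
    * of_nat ((q + l - 1) choose l) * (c * \<alpha> ^ (n - 2 * q - l) * \<beta> ^ q * \<gamma> ^ l)" for n q l
  have tP: "t n q l \<in> P" for n q l
    unfolding t_def using P by (intro nonneg_Laurent_closed)
  have uP: "u n \<in> P" for n
    unfolding coeff using tP by (intro nonneg_Laurent_sum) (simp add: t_def)
  have u_ge: "u n - t n q l \<in> P" if "2 * q + l \<le> n" for n q l
  proof -
    let ?A = "SIGMA q:{..n}. {l. 2 * q + l \<le> n}"
    have "u n = (\<Sum>(q, l)\<in>?A. t n q l)"
      unfolding coeff t_def[symmetric] by (rule sum.Sigma) (simp_all add: finite_le_nat_combination)
    also have "\<dots> = t n q l + (\<Sum>(q, l)\<in>?A - {(q, l)}. t n q l)"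
      using that by (subst sum.remove[of _ "(q, l)"]) (auto simp: finite_le_nat_combination)
    finally show ?thesis by (auto intro!: nonneg_Laurent_sum tP)
  qed
  \<comment> \<open>For q = l = 0 both binomials are 1; the second is \<open>0 choose 0\<close>
    because 0 - 1 truncates to 0.\<close>
  have "u (Suc k) - c * \<alpha> ^ Suc k \<in> P"
    using u_ge[of 0 0 "Suc k"] by (simp add: t_def)
  moreover have "c * \<alpha> ^ Suc k - c * \<alpha>' ^ Suc k \<in> P"
    using P ge nonneg_Laurent.zero
    by (intro nonneg_Laurent_diff_mult nonneg_Laurent_diff_power nonneg_Laurent_power) auto
  ultimately have 1: "u (Suc k) - c * \<alpha>' ^ Suc k \<in> P"
    using nonneg_Laurent_add by fastforce
  \<comment> \<open>For q = 1 and l = k no power of \<alpha> is left, and both binomials are again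
    1.\<close>
  have "u (Suc (Suc k)) - c * \<beta> * \<gamma> ^ k \<in> P"
    using u_ge[of 1 k "Suc (Suc k)"] by (simp add: t_def)
  moreover have "c * \<beta> * \<gamma> ^ k - c * \<beta>' * \<gamma>' ^ k \<in> P"
    using P ge nonneg_Laurent.zero
    by (intro nonneg_Laurent_diff_mult nonneg_Laurent_diff_power nonneg_Laurent_power
        nonneg_Laurent_mult nz) auto
  ultimately have 2: "u (Suc (Suc k)) - c * \<beta>' * \<gamma>' ^ k \<in> P"
    using nonneg_Laurent_add by fastforce
  have "u (Suc k) * u (Suc (Suc k)) - (c * \<alpha>' ^ Suc k) * (c * \<beta>' * \<gamma>' ^ k) \<in> P"
    using 1 2 P uP by (intro nonneg_Laurent_diff_mult nonneg_Laurent_closed)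
  then show ?thesis unfolding prod .
qed

end

subsection \<open>The cluster variables\<close>

lemma even_terms_recurrence:
  fixes u w :: "nat \<Rightarrow> 'a::field"
  assumes nz: "\<And>n. u n \<noteq> 0" "\<And>n. w n \<noteq> 0"
    and u: "\<And>n. u (Suc n) * u n = 1 + w n"
    and w: "\<And>n. w (Suc n) * w n = 1 + u (Suc n) ^ 4"
  shows "u (Suc (Suc n)) = (u 0 ^ 2 + u 1 ^ 2) / w 0 * u (Suc n) - u n"
proof -
  define K where "K n = (u n ^ 2 + u (Suc n) ^ 2) / w n" for n
  \<comment> \<open>The sum of the two neighbours of \<open>u (Suc n)\<close> is computed once with
    \<open>K n\<close> and once with \<open>K (Suc n)\<close>; comparing the results shows that
    \<open>K\<close> is constant.\<close>
  have left: "u n + u (Suc (Suc n)) = K n * u (Suc n)" for n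
  proof -
    \<comment> \<open>The extra factor creates products of neighbours, to which the exchange
      relations apply: both sides become (1 + \<open>w n\<close>)^2 +
      \<open>u (Suc n) ^ 4\<close>.\<close>
    have "u (Suc n) * (w n * (u n + u (Suc (Suc n)))) = u (Suc n) * (u (Suc n) * (u n ^ 2 + u (Suc n) ^ 2))"
      using u[of n] u[of "Suc n"] w[of n] by algebra
    then have "w n * (u n + u (Suc (Suc n))) = u (Suc n) * (u n ^ 2 + u (Suc n) ^ 2)"
      using nz by (metis mult_left_cancel)
    then show ?thesis using nz by (simp add: K_def field_simps)
  qed
  have right: "u n + u (Suc (Suc n)) = K (Suc n) * u (Suc n)" for n
  proof -
    have "u (Suc n) * (w (Suc n) * (u n + u (Suc (Suc n))))
        = u (Suc n) * (u (Suc n) * (u (Suc n) ^ 2 + u (Suc (Suc n)) ^ 2))"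
      using u[of n] u[of "Suc n"] w[of n] by algebra
    then have "w (Suc n) * (u n + u (Suc (Suc n))) = u (Suc n) * (u (Suc n) ^ 2 + u (Suc (Suc n)) ^ 2)"
      using nz by (metis mult_left_cancel)
    then show ?thesis using nz by (simp add: K_def field_simps)
  qed
  have "K n = K 0" for n
  proof (induction n)
    case (Suc n)
    have "K (Suc n) = K n" using left[of n] right[of n] nz by (metis mult_right_cancel)
    then show ?case using Suc by simp
  qed simp
  then have "u n + u (Suc (Suc n)) = K 0 * u (Suc n)" using left by simp
  then have "u (Suc (Suc n)) = K 0 * u (Suc n) - u n" by (simp add: algebra_simps)
  then show ?thesis by (simp add: K_def)
qed

theorem mainTheorem2:
  fixes x :: "int \<Rightarrow> ratfun2"
    and y :: "nat \<Rightarrow> nat \<Rightarrow> ratfun2"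
  assumes x0: "x 0 = X0" and x1: "x 1 = X1"
    and even_rec: "\<And>n. x (2*n) * x (2*n - 2) = 1 + x (2*n - 1)"
    and odd_rec: "\<And>n. x (2*n + 1) * x (2*n - 1) = 1 + x (2*n) ^ 4"
    and y01: "y 0 1 = (1 + x 1) / x 0 ^ 2"
    and y02: "y 0 2 = (x 0 ^ 4 + (1 + x 1) ^ 2) / (x 0 ^ 4 * x 1)"
    and y03: "y 0 3 = (x 0 ^ 4 + 1 + x 1) / (x 0 ^ 2 * x 1)"
    and y11: "y 1 1 = (x 2 ^ 4 + 1 + x 1) / (x 2 ^ 2 * x 1)"
    and y12: "y 1 2 = (x 2 ^ 4 + (1 + x 1) ^ 2) / (x 2 ^ 4 * x 1)"
    and y13: "y 1 3 = (1 + x 1) / x 2 ^ 2"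
  shows
    "Abs_fps (\<lambda>n. x (2 * int n)) =
       fps_const (x 0) / (1 - fps_X * fps_const (y 0 1)
         - fps_X ^ 2 * fps_const (y 0 2) / (1 - fps_X * fps_const (y 0 3)))
     \<and>
     Abs_fps (\<lambda>n. x (2 * int n + 2)) =
       fps_const (x 2) / (1 - fps_X * fps_const (y 1 1)
         - fps_X ^ 2 * fps_const (y 1 2) / (1 - fps_X * fps_const (y 1 3)))
     \<and>
     (\<forall>n::nat.
       x (2 * int n) =
         Sum_any (\<lambda>(q::nat, l::nat, r::nat, s::nat, m::nat).
           x 0 powi (1 + 4 * (int q + int l) - 2 * int n - 4 * (int r + int s))
           * x 1 powi (int m - int q - int l)
           * of_nat (multinom (int n - int q - int l) [int q - int r, int r])
           * of_nat (multinom (int q + int l - 1) [int l - int s, int s])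
           * of_nat (multinom (int n + 2 * int r + int s - 2 * int q - int l) [int m])))
     \<and>
     (\<forall>n::nat.
       x (2 * int n + 2) =
         Sum_any (\<lambda>(q::nat, l::nat, r::nat, s::nat, m::nat).
           x 2 powi (1 + 2 * int n - 4 * (int q + int l + int r + int s))
           * x 1 powi (int q + int l + int m - int n)
           * of_nat (multinom (int n - int q - int l) [int q - int r, int r, int s])
           * of_nat (multinom (int q + int l - 1) [int l])
           * of_nat (multinom (2 * int r + int s + int l) [int m])))
     \<and>
     (\<forall>n::nat.
       x (2 * int n + 1) = x (2 * int n) * x (2 * int n + 2) - 1 \<and>
       nonneg_int_Laurent_in (x 0) (x 1) (x (2 * int n + 1)) \<and>
       nonneg_int_Laurent_in (x 1) (x 2) (x (2 * int n + 1)))"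
proof -
  define u where "u n = x (2 * int n)" for n
  define w where "w n = x (2 * int n + 1)" for n
  have u_rec: "u (Suc n) * u n = 1 + w n" for n
    using even_rec[of "int n + 1"] by (simp add: u_def w_def algebra_simps)
  have w_rec: "w (Suc n) * w n = 1 + u (Suc n) ^ 4" for n
    using odd_rec[of "int n + 1"] by (simp add: u_def w_def algebra_simps)
  \<comment> \<open>The recursion is subtraction-free, so positivity at (1, 1) propagates; it
    supplies the non-vanishing behind every later division.\<close>
  have pos: "pos_ratfun (u n) \<and> pos_ratfun (w n)" for n
  proof (induction n)
    case 0
    show ?case by (simp add: u_def w_def x0 x1 pos_ratfun_X0 pos_ratfun_X1)
  next
    case (Suc n)
    then have nz: "u n \<noteq> 0" "w n \<noteq> 0" using pos_ratfun_nonzero by blast+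
    have "u (Suc n) = (1 + w n ^ 1) / u n" using u_rec[of n] nz by (simp add: field_simps)
    then have "pos_ratfun (u (Suc n))" using Suc pos_ratfun_step by metis
    moreover have "w (Suc n) = (1 + u (Suc n) ^ 4) / w n"
      using w_rec[of n] nz by (simp add: field_simps)
    ultimately show ?case using Suc pos_ratfun_step by metis
  qed
  then have u_nz: "u n \<noteq> 0" and w_nz: "w n \<noteq> 0" for n
    using pos_ratfun_nonzero by blast+
  define v where "v n = u (Suc n)" for n
  have x_u: "x (2 * int n) = u n" "x (2 * int n + 2) = v n" "x (2 * int n + 1) = w n" for n
    by (simp_all add: u_def v_def w_def algebra_simps)
  have x012: "x 0 = u 0" "x 1 = w 0" "x 2 = v 0"
    by (simp_all add: u_def w_def v_def)
  have v0: "v 0 * u 0 = 1 + w 0" using u_rec[of 0] by (simp add: v_def)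
  have K0: "y 0 1 + y 0 3 = (u 0 ^ 2 + v 0 ^ 2) / w 0"
  proof -
    have v: "v 0 = (1 + w 0) / u 0" using v0 u_nz by (simp add: field_simps)
    show ?thesis unfolding y01 y03 x012 v using u_nz[of 0] w_nz[of 0]
      by (simp add: field_simps power2_eq_square) algebra
  qed
  have K1: "y 1 1 + y 1 3 = (u 0 ^ 2 + v 0 ^ 2) / w 0"
  proof -
    \<comment> \<open>The second family of \<open>y\<close> is written in \<open>v 0\<close> and
      \<open>w 0\<close>, so \<open>u 0\<close> is eliminated here, whereas \<open>K0\<close>
      eliminates \<open>v 0\<close>.\<close>
    have u: "u 0 = (1 + w 0) / v 0" using v0 u_nz[of 1] by (simp add: field_simps v_def)
    show ?thesis unfolding y11 y13 x012 u using u_nz[of 1] w_nz[of 0]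
      by (simp add: field_simps power2_eq_square v_def) algebra
  qed
  have det0: "y 0 1 * y 0 3 - y 0 2 = 1"
    unfolding y01 y02 y03 x012 using u_nz[of 0] w_nz[of 0]
    by (simp add: field_simps) algebra
  have det1: "y 1 1 * y 1 3 - y 1 2 = 1"
    unfolding y11 y12 y13 x012 using u_nz[of 1] w_nz[of 0]
    by (simp add: field_simps v_def) algebra
  have u1: "u (Suc 0) = y 0 1 * u 0"
    unfolding y01 x012 using v0 u_nz[of 0] by (simp add: field_simps v_def power2_eq_square)
  have v1: "v (Suc 0) = y 1 1 * v 0"
  proof -
    have "v 1 * v 0 * w 0 = w 0 + 1 + v 0 ^ 4"
      using u_rec[of 1] w_rec[of 0] by (simp add: v_def algebra_simps)
    then show ?thesis
      unfolding y11 x012 using u_nz[of 1] w_nz[of 0]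
      by (simp add: field_simps v_def power2_eq_square) algebra
  qed
  have lin: "u (Suc (Suc n)) = (u 0 ^ 2 + v 0 ^ 2) / w 0 * u (Suc n) - u n" for n
    using even_terms_recurrence[of u w n] u_nz w_nz u_rec w_rec by (simp add: v_def)
  have lin_v: "v (Suc (Suc n)) = (u 0 ^ 2 + v 0 ^ 2) / w 0 * v (Suc n) - v n" for n
    using lin[of "Suc n"] by (simp only: v_def)
  have F0: "Abs_fps u = fps_const (u 0) / (1 - fps_X * fps_const (y 0 1)
         - fps_X ^ 2 * fps_const (y 0 2) / (1 - fps_X * fps_const (y 0 3)))"
    by (rule continued_fraction_of_recurrence) (simp_all only: u1 det0 K0 lin)
  have F1: "Abs_fps v = fps_const (v 0) / (1 - fps_X * fps_const (y 1 1)
         - fps_X ^ 2 * fps_const (y 1 2) / (1 - fps_X * fps_const (y 1 3)))"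
    by (rule continued_fraction_of_recurrence) (simp_all only: v1 det1 K1 lin_v)
  have u_coeff: "u n = (\<Sum>q\<le>n. \<Sum>l | 2 * q + l \<le> n. of_nat ((n - q - l) choose q)
      * of_nat ((q + l - 1) choose l) * (u 0 * y 0 1 ^ (n - 2 * q - l) * y 0 2 ^ q * y 0 3 ^ l))" for n
    using arg_cong[OF F0, of "\<lambda>F. F $ n"] unfolding continued_fraction_nth by simp
  have v_coeff: "v n = (\<Sum>q\<le>n. \<Sum>l | 2 * q + l \<le> n. of_nat ((n - q - l) choose q)
      * of_nat ((q + l - 1) choose l) * (v 0 * y 1 1 ^ (n - 2 * q - l) * y 1 2 ^ q * y 1 3 ^ l))" for n
    using arg_cong[OF F1, of "\<lambda>F. F $ n"] unfolding continued_fraction_nth by simp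
  have v0_nz: "v 0 \<noteq> 0" using u_nz by (simp add: v_def)
  have w_eq: "w n = u n * v n - 1" for n
    using u_rec[of n] by (simp add: v_def algebra_simps)
  have pos_01: "w n \<in> nonneg_Laurent (u 0) (w 0)" for n
  proof (cases n)
    case 0
    then show ?thesis by (simp add: nonneg_Laurent_gens)
  next
    case (Suc k)
    note nz = u_nz[of 0] w_nz[of 0]
    \<comment> \<open>The primed values are monomials occurring in \<open>y 0 1\<close>,
      \<open>y 0 2\<close>, \<open>y 0 3\<close>, chosen with \<alpha>' \<gamma>' = 1 and c^2
      \<alpha>' \<beta>' = 1 for c = \<open>u 0\<close>; hence the required product is 1 for every
      k.\<close>
    have "u (Suc k) * u (Suc (Suc k)) - 1 \<in> nonneg_Laurent (u 0) (w 0)"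
    proof (rule nonneg_Laurent_consecutive_product_minus_1[OF nz u_coeff,
          where \<alpha>' = "w 0 / u 0 ^ 2" and \<beta>' = "1 / w 0" and \<gamma>' = "u 0 ^ 2 / w 0"])
      have "y 0 1 - w 0 / u 0 ^ 2 = inverse (u 0) ^ 2"
        "y 0 2 - 1 / w 0 = (1 + w 0) ^ 2 * inverse (u 0) ^ 4 * inverse (w 0)"
        "y 0 3 - u 0 ^ 2 / w 0 = (1 + w 0) * inverse (u 0) ^ 2 * inverse (w 0)"
        unfolding y01 y02 y03 x012 using nz by (simp_all add: field_simps power2_eq_square power4_eq_xxxx)
      then show "y 0 1 - w 0 / u 0 ^ 2 \<in> nonneg_Laurent (u 0) (w 0)"
        "y 0 2 - 1 / w 0 \<in> nonneg_Laurent (u 0) (w 0)"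
        "y 0 3 - u 0 ^ 2 / w 0 \<in> nonneg_Laurent (u 0) (w 0)"
        by (simp_all only:) (intro nonneg_Laurent_closed[OF nz])+
      show "u 0 * (w 0 / u 0 ^ 2) ^ Suc k * (u 0 * (1 / w 0) * (u 0 ^ 2 / w 0) ^ k) = 1"
        using nz by (simp add: power_divide field_simps power2_eq_square)
    \<comment> \<open>Divisions are rewritten as products with inverses of the generators, so that
      the closure rules apply.\<close>
    qed (unfold y01 y02 y03 x012 divide_inverse power_inverse[symmetric] inverse_mult_distrib,
        (intro nonneg_Laurent_closed[OF nz])+)
    then show ?thesis by (simp add: Suc w_eq v_def)
  qed
  have pos_12: "w n \<in> nonneg_Laurent (v 0) (w 0)" for n
  proof -
    note nz = v0_nz w_nz[of 0]
    \<comment> \<open>Since \<open>v\<close> is shifted by one, \<open>w n\<close> is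
      \<open>v (n - 1) * v n - 1\<close>, and the product lemma starts at n = 2. The case n = 1 is
      read off from the exchange relation.\<close>
    consider "n = 0" | "n = 1" | k where "n = Suc (Suc k)"
      using not0_implies_Suc[of n] not0_implies_Suc[of "n - 1"] by fastforce
    then show ?thesis
    proof cases
      case 1
      then show ?thesis by (simp add: nonneg_Laurent_gens)
    next
      case 2
      have "w 1 = (1 + v 0 ^ 4) * inverse (w 0)"
        using w_rec[of 0] nz by (simp add: v_def field_simps)
      then show ?thesis unfolding 2 by (simp only:) (intro nonneg_Laurent_closed[OF nz])
    next
      case 3
      \<comment> \<open>The same two conditions hold with c = \<open>v 0\<close>. Here \<beta>' is
        the monomial of \<open>y 1 2\<close> that stems from the square of \<open>w 0\<close> in
        \<open>(1 + w 0) ^ 2\<close>.\<close>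
      have "v (Suc k) * v (Suc (Suc k)) - 1 \<in> nonneg_Laurent (v 0) (w 0)"
      proof (rule nonneg_Laurent_consecutive_product_minus_1[OF nz v_coeff,
            where \<alpha>' = "v 0 ^ 2 / w 0" and \<beta>' = "w 0 / v 0 ^ 4" and \<gamma>' = "w 0 / v 0 ^ 2"])
        have "y 1 1 - v 0 ^ 2 / w 0 = (1 + w 0) * inverse (v 0) ^ 2 * inverse (w 0)"
          "y 1 2 - w 0 / v 0 ^ 4 = inverse (w 0) + (1 + w 0 + w 0) * inverse (v 0) ^ 4 * inverse (w 0)"
          "y 1 3 - w 0 / v 0 ^ 2 = inverse (v 0) ^ 2"
          unfolding y11 y12 y13 x012 using nz by (simp_all add: field_simps power2_eq_square power4_eq_xxxx)
        then show "y 1 1 - v 0 ^ 2 / w 0 \<in> nonneg_Laurent (v 0) (w 0)"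
          "y 1 2 - w 0 / v 0 ^ 4 \<in> nonneg_Laurent (v 0) (w 0)"
          "y 1 3 - w 0 / v 0 ^ 2 \<in> nonneg_Laurent (v 0) (w 0)"
          by (simp_all only:) (intro nonneg_Laurent_closed[OF nz])+
        show "v 0 * (v 0 ^ 2 / w 0) ^ Suc k * (v 0 * (w 0 / v 0 ^ 4) * (w 0 / v 0 ^ 2) ^ k) = 1"
          using nz by (simp add: power_divide field_simps power2_eq_square power4_eq_xxxx)
      qed (unfold y11 y12 y13 x012 divide_inverse power_inverse[symmetric] inverse_mult_distrib,
          (intro nonneg_Laurent_closed[OF nz])+)
      then show ?thesis by (simp add: 3 w_eq v_def)
    qed
  qed
  show ?thesis
    unfolding x_u x012
  proof (intro conjI allI)
    show "Abs_fps u = fps_const (u 0) / (1 - fps_X * fps_const (y 0 1)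
         - fps_X ^ 2 * fps_const (y 0 2) / (1 - fps_X * fps_const (y 0 3)))"
      by (rule F0)
    show "Abs_fps v = fps_const (v 0) / (1 - fps_X * fps_const (y 1 1)
         - fps_X ^ 2 * fps_const (y 1 2) / (1 - fps_X * fps_const (y 1 3)))"
      by (rule F1)
    fix n
    show "w n = u n * v n - 1" by (rule w_eq)
    show "nonneg_int_Laurent_in (u 0) (w 0) (w n)"
      using pos_01 by (rule nonneg_Laurent_imp_nonneg_int_Laurent_in)
    show "nonneg_int_Laurent_in (w 0) (v 0) (w n)"
      using pos_12 unfolding nonneg_Laurent_commute[of "v 0"]
      by (rule nonneg_Laurent_imp_nonneg_int_Laurent_in)
  qed (rule trans[OF u_coeff Laurent_expansion_0[OF u_nz[of 0] w_nz[of 0] y01[unfolded x012]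
            y02[unfolded x012] y03[unfolded x012]]],
      rule trans[OF v_coeff Laurent_expansion_1[OF v0_nz w_nz[of 0] y11[unfolded x012]
            y12[unfolded x012] y13[unfolded x012]]])
qed

end
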